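(* If $R$ is a commutative integral domain of finite (Krull) dimension, then $R$ is Hopfian.
   Context: All rings are commutative with a non-zero identity. A ring $A$ is called Hopfian if every surjective ring homomorphism $A\to A$ is an automorphism. *)

theory Defs
  imports "HOL-Algebra.Algebra" "HOL-Library.Extended_Nat"
begin

text \<open>
  A chain of length \<open>n\<close> consists of \<open>n + 1\<close> prime ideals related by \<open>n\<close> proper inclusions
  \<open>P 0 \<subset> \<dots> \<subset> P n\<close>; the values of \<open>P\<close> beyond \<open>n\<close> are irrelevant.
\<close>

definition prime_ideal_chain :: "('a, 'b) ring_scheme \<Rightarrow> nat \<Rightarrow> (nat \<Rightarrow> 'a set) \<Rightarrow> bool" where
  "prime_ideal_chain R n P \<longleftrightarrow>
     (\<forall>i\<le>n. primeideal (P i) R) \<and> (\<forall>i<n. P i \<subset> P (Suc i))"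

text \<open>
  The supremum is taken in \<^typ>\<open>enat\<close>, so it is \<open>\<infinity>\<close> when chain lengths are unbounded. For the zero
  ring, which has no prime ideals, the value is \<open>0\<close>; that case is excluded in what follows.
\<close>

definition krull_dim :: "('a, 'b) ring_scheme \<Rightarrow> enat" where
  "krull_dim R = Sup {enat n | n. \<exists>P. prime_ideal_chain R n P}"

text \<open>
  \<^const>\<open>ring_hom\<close> requires preservation of \<open>\<one>\<close>, and its members are only constrained on the carrier.
\<close>

definition hopfian :: "('a, 'b) ring_scheme \<Rightarrow> bool" where
  "hopfian R \<longleftrightarrow>
     (\<forall>h \<in> ring_hom R R. h ` carrier R = carrier R \<longrightarrow> h \<in> ring_iso R R)"

end

theory Submission
  imports Defs
begin

text \<open>
  If a surjective endomorphism \<open>h\<close> of a domain had a non-zero kernel, then pulling a chain of prime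
  ideals back along \<open>h\<close> would give a chain of the same length all of whose members contain the
  kernel, and the zero ideal could be prepended to it. So there would be chains of every length.
\<close>

text \<open>Surjectivity is what keeps the inclusions proper: an element of \<open>P (Suc i)\<close>
  outside \<open>P i\<close> lifts to \<open>R\<close>, and its lift separates the two
  preimages.\<close>

lemma (in ring_hom_ring) prime_ideal_chain_vimage:
  assumes "cring R"
    and "prime_ideal_chain S n P"
    and surj: "h ` carrier R = carrier S"
  shows "prime_ideal_chain R n (\<lambda>i. {r \<in> carrier R. h r \<in> P i})"
proof -
  have prime: "primeideal (P i) S" if "i \<le> n" for i
    using assms that by (simp add: prime_ideal_chain_def)
  have "{r \<in> carrier R. h r \<in> P i} \<subset> {r \<in> carrier R. h r \<in> P (Suc i)}" if "i < n" for i
  proof -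
    have sub: "P i \<subset> P (Suc i)"
      using assms that by (simp add: prime_ideal_chain_def)
    then obtain s where s: "s \<in> P (Suc i)" "s \<notin> P i" by auto
    have "ideal (P (Suc i)) S"
      using prime[of "Suc i"] that by (simp add: primeideal.axioms(1))
    then have "s \<in> h ` carrier R"
      unfolding surj using s(1) by (rule ideal.Icarr)
    then obtain r where "r \<in> carrier R" "h r = s" by blast
    then show ?thesis using s sub by auto
  qed
  then show ?thesis
    using prime primeideal_vimage[OF assms(1)] by (simp add: prime_ideal_chain_def)
qed

text \<open>In a domain the zero ideal is prime, and it lies in every ideal, so
  \<open>P 0 \<noteq> {\<zero>}\<close> makes the new first inclusion proper.\<close>

lemma (in domain) prime_ideal_chain_extend:
  assumes "prime_ideal_chain R n P" and "P 0 \<noteq> {\<zero>}"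
  shows "prime_ideal_chain R (Suc n) (\<lambda>i. case i of 0 \<Rightarrow> {\<zero>} | Suc j \<Rightarrow> P j)"
proof -
  have "primeideal (P 0) R"
    using assms by (simp add: prime_ideal_chain_def)
  then have "\<zero> \<in> P 0"
    by (simp add: primeideal.axioms(1) additive_subgroup.zero_closed ideal.axioms(1))
  then show ?thesis
    using assms zeroprimeideal
    by (auto simp: prime_ideal_chain_def split: nat.split)
qed

theorem theorem2p2:
  fixes R :: "('a, 'b) ring_scheme"
  assumes "domain R"
    and "krull_dim R < \<infinity>"
  shows "hopfian R"
  unfolding hopfian_def
proof (intro ballI impI)
  fix h assume hom: "h \<in> ring_hom R R" and surj: "h ` carrier R = carrier R"
  interpret domain R by fact
  have h: "ring_hom_ring R R h"
    by (intro ring_hom_ringI2 ring_axioms hom)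
  have "inj_on h (carrier R)"
  proof (rule ccontr)
    assume "\<not> inj_on h (carrier R)"
    then have "a_kernel R R h \<noteq> {\<zero>\<^bsub>R\<^esub>}"
      using ring_hom_ring.trivial_ker_imp_inj[OF h] by blast
    \<comment> \<open>Since the kernel contains zero, differing from the zero ideal means having a
      non-zero element.\<close>
    moreover have "\<zero>\<^bsub>R\<^esub> \<in> a_kernel R R h"
      by (simp add: a_kernel_def' ring_hom_zero[OF hom ring_axioms ring_axioms])
    ultimately obtain k where "k \<in> a_kernel R R h" and "k \<noteq> \<zero>\<^bsub>R\<^esub>"
      by blast
    then have k: "k \<in> carrier R" "h k = \<zero>\<^bsub>R\<^esub>" "k \<noteq> \<zero>\<^bsub>R\<^esub>"
      by (auto simp: a_kernel_def')
    \<comment> \<open>The chain is existentially quantified because each step replaces all of its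
      members by their preimages; the element \<open>k\<close> stays fixed.\<close>
    have "\<exists>P. prime_ideal_chain R n P" for n
    proof (induction n)
      case 0
      have "prime_ideal_chain R 0 (\<lambda>_. {\<zero>\<^bsub>R\<^esub>})"
        using zeroprimeideal by (simp add: prime_ideal_chain_def)
      then show ?case by (rule exI[of "prime_ideal_chain R 0"])
    next
      case (Suc n)
      then obtain P where P: "prime_ideal_chain R n P" by auto
      let ?Q = "\<lambda>i. {r \<in> carrier R. h r \<in> P i}"
      have "primeideal (P 0) R"
        using P by (simp add: prime_ideal_chain_def)
      then have "\<zero>\<^bsub>R\<^esub> \<in> P 0"
        by (simp add: primeideal.axioms(1) additive_subgroup.zero_closed ideal.axioms(1))
      \<comment> \<open>As \<open>h k\<close> is zero, \<open>k\<close> lies in the preimage of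
        \<open>P 0\<close> even when \<open>P 0\<close> is the zero ideal, which makes room below
        \<open>?Q 0\<close>.\<close>
      with k have "k \<in> ?Q 0" by simp
      with k(3) have "?Q 0 \<noteq> {\<zero>\<^bsub>R\<^esub>}" by blast
      with ring_hom_ring.prime_ideal_chain_vimage[OF h is_cring P surj]
      have "prime_ideal_chain R (Suc n) (\<lambda>i. case i of 0 \<Rightarrow> {\<zero>\<^bsub>R\<^esub>} | Suc j \<Rightarrow> ?Q j)"
        by (rule prime_ideal_chain_extend)
      then show ?case by (rule exI[of "prime_ideal_chain R (Suc n)"])
    qed
    then have "enat n \<le> krull_dim R" for n
      unfolding krull_dim_def by (intro Sup_upper) auto
    moreover obtain m where "krull_dim R = enat m"
      using assms(2) by (cases "krull_dim R") auto
    \<comment> \<open>A chain one step longer than the finite dimension \<open>m\<close> gives the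
      contradiction.\<close>
    ultimately have "enat (Suc m) \<le> enat m"
      by simp
    then show False
      by simp
  qed
  then show "h \<in> ring_iso R R"
    using hom surj by (simp add: ring_iso_def bij_betw_def)
qed

end
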